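(* Every oriented graph $D$ with $\delta^+(D) \geq 2$ contains a subdivision of $C(2,2)$.
   Context: Digraphs are finite, without loops or parallel arcs. An oriented graph is a digraph with no digon (no pair of opposite arcs $uv, vu$), i.e. of digirth at least $3$. $\delta^+(D)$ is the minimum out-degree. $C(2,2)$ is the union of two internally vertex-disjoint directed paths of length $2$ from a vertex $x$ to a vertex $y$. A subdivision of a digraph $F$ is obtained by replacing each arc $uv$ by a directed path from $u$ to $v$; $D$ contains a subdivision of $F$ if some subdigraph of $D$ is one. *)

theory Defs
  imports "Graph_Theory.Graph_Theory"
begin

text \<open>Loops are already excluded by \<open>digraph\<close>, so excluding digons means digirth at least 3.\<close>

locale oriented_graph = digraph +
  assumes no_digon: "u \<rightarrow>\<^bsub>G\<^esub> v \<Longrightarrow> \<not> v \<rightarrow>\<^bsub>G\<^esub> u"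

text \<open>Meaningful only for finite digraphs with at least one vertex (\<open>Min\<close> of the empty set
  is unspecified).\<close>

definition min_out_degree :: "('a, 'b) pre_digraph \<Rightarrow> nat" where
  "min_out_degree G = Min (out_degree G ` verts G)"

text \<open>
  The relation \<open>subdivision\<close> of the library concerns bidirected digraphs (that is, undirected
  graphs), where an arc and its reverse are subdivided together, so it does not apply here.

  Below, \<open>H\<close> arises from \<open>F\<close>, up to renaming of vertices and arcs, by replacing every arc \<open>a\<close>
  with the directed path \<open>P a\<close>; the map \<open>\<phi>\<close> gives the branch vertices. The replacing paths have
  pairwise distinct new inner vertices, and \<open>H\<close> has no other vertices or arcs. As \<open>F\<close> has no
  loops, the ends of \<open>P a\<close> are distinct, so \<open>P a\<close> has at least one arc; length one leaves \<open>a\<close>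
  unsubdivided. \<open>inner_verts\<close> omits both ends of a path.
\<close>

definition is_disubdivision :: "('a, 'b) pre_digraph \<Rightarrow> ('c, 'd) pre_digraph \<Rightarrow> bool" where
  "is_disubdivision F H \<longleftrightarrow>
     digraph F \<and> digraph H \<and>
     (\<exists>\<phi> P.
        inj_on \<phi> (verts F) \<and> \<phi> ` verts F \<subseteq> verts H \<and>
        (\<forall>a \<in> arcs F. pre_digraph.apath H (\<phi> (tail F a)) (P a) (\<phi> (head F a))) \<and>
        (\<forall>a \<in> arcs F. set (pre_digraph.inner_verts H (P a)) \<inter> \<phi> ` verts F = {}) \<and>
        (\<forall>a \<in> arcs F. \<forall>b \<in> arcs F. a \<noteq> b \<longrightarrow>
           set (pre_digraph.inner_verts H (P a)) \<inter> set (pre_digraph.inner_verts H (P b)) = {}) \<and>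
        verts H = \<phi> ` verts F \<union> (\<Union>a \<in> arcs F. set (pre_digraph.inner_verts H (P a))) \<and>
        arcs H = (\<Union>a \<in> arcs F. set (P a)))"

definition contains_disubdivision :: "('c, 'd) pre_digraph \<Rightarrow> ('a, 'b) pre_digraph \<Rightarrow> bool" where
  "contains_disubdivision D F \<longleftrightarrow> (\<exists>H. subgraph H D \<and> is_disubdivision F H)"

text \<open>\<open>C(2,2)\<close> with \<open>x = 0\<close>, \<open>y = 3\<close> and the directed paths \<open>0, 1, 3\<close> and \<open>0, 2, 3\<close>.\<close>

definition C22 :: "nat pair_pre_digraph" where
  "C22 = \<lparr> pverts = {0, 1, 2, 3}, parcs = {(0, 1), (1, 3), (0, 2), (2, 3)} \<rparr>"

lemma digraph_C22: "digraph (with_proj C22)"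
  by unfold_locales (auto simp: C22_def arc_to_ends_def)

end

theory Submission
  imports Defs
begin

text \<open>Let \<open>W\<close> be a minimal nonempty set of vertices closed under out-neighbours, and \<open>S \<subseteq> W\<close> a
  minimal nonempty set with at most one out-neighbour outside itself. Removing a vertex from a
  closed set shows that \<open>S\<close> has exactly one, \<open>d\<close>, and minimality makes \<open>S\<close> strong. Suppose
  \<open>x \<in> S\<close> dominates both \<open>d\<close> and \<open>a \<in> S\<close>. By minimality of \<open>S\<close> no vertex other than \<open>a\<close>
  separates \<open>a\<close> from \<open>{x, d}\<close>, so \<open>a\<close> has disjoint paths to \<open>x\<close> and to \<open>d\<close>; extending the first
  by the arc \<open>x d\<close> gives the subdivision unless \<open>a\<close> dominates \<open>d\<close>. Hence every vertex of \<open>S\<close>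
  dominates \<open>d\<close>. By minimality of \<open>W\<close> there is a path from \<open>d\<close> back to \<open>S\<close>, first meeting it
  in \<open>s\<close>, say. If \<open>x \<in> S\<close> is an out-neighbour of \<open>s\<close>, then the path from \<open>x\<close> through \<open>d\<close> to \<open>s\<close>
  and a path from \<open>x\<close> to \<open>s\<close> inside \<open>S\<close> form the subdivision; neither is a single arc, as there
  are no digons.\<close>

section \<open>Walks as vertex lists, and minimal sets\<close>

lemmas successively_simps = successively_append_iff successively_Cons hd_append

text \<open>Induction along the reachability: a step to a vertex already on the walk cuts the walk
  back to that occurrence. The start \<open>a\<close> need not lie in \<open>S\<close>.\<close>

lemma rtranclp_into_distinct_walk:
  assumes "(\<lambda>u w. E u w \<and> w \<in> S)\<^sup>*\<^sup>* a b"
  shows "\<exists>xs. successively E (a # xs) \<and> last (a # xs) = b \<and> set xs \<subseteq> S \<and> distinct (a # xs)"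
  using assms
proof (induction rule: rtranclp_induct)
  case base
  show ?case by (rule exI[of _ "[]"]) simp
next
  case (step b c)
  then obtain xs where xs: "successively E (a # xs)" "last (a # xs) = b" "set xs \<subseteq> S"
    "distinct (a # xs)" by blast
  show ?case
  proof (cases "c \<in> set (a # xs)")
    case True
    then obtain ys zs where split: "a # xs = ys @ c # zs" by (meson split_list)
    show ?thesis
    proof (cases ys)
      case Nil
      then show ?thesis using split by (intro exI[of _ "[]"]) simp
    next
      case (Cons y ys')
      then have xs_eq: "xs = ys' @ c # zs" using split by auto
      then have "successively E ((a # ys' @ [c]) @ zs)" using xs(1) by simp
      then have "successively E (a # ys' @ [c])" by (simp only: successively_append_iff)
      then show ?thesis using xs(3,4) xs_eq by (intro exI[of _ "ys' @ [c]"]) auto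
    qed
  next
    case False
    have "successively E ((a # xs) @ [c])"
      using xs(1,2) step.hyps(2) by (subst successively_append_iff) auto
    then show ?thesis using xs(3,4) False step.hyps(2)
      by (intro exI[of _ "xs @ [c]"]) auto
  qed
qed

lemma minimal_subset:
  assumes "finite V" "P V"
  obtains W where "W \<subseteq> V" "P W" "\<And>U. U \<subseteq> W \<Longrightarrow> P U \<Longrightarrow> U = W"
proof -
  have "finite {U. U \<subseteq> V \<and> P U}" using assms(1) by simp
  from finite_has_minimal2[OF this, of V] assms(2) obtain W where
    "W \<in> {U. U \<subseteq> V \<and> P U}" "\<forall>b\<in>{U. U \<subseteq> V \<and> P U}. b \<le> W \<longrightarrow> W = b" by blast
  then show thesis by (intro that[of W]) auto
qed

section \<open>From vertex lists to arc paths\<close>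

context wf_digraph
begin

lemma successively_dominates_imp_arcs:
  assumes "successively (dominates G) (u # xs)"
  shows "\<exists>P. set P \<subseteq> arcs G \<and> cas u P (last (u # xs)) \<and> awalk_verts u P = u # xs"
  using assms
proof (induction xs arbitrary: u)
  case Nil
  show ?case by (rule exI[of _ "[]"]) simp
next
  case (Cons w xs)
  then obtain P where "set P \<subseteq> arcs G" "cas w P (last (w # xs))" "awalk_verts w P = w # xs" by auto
  moreover obtain e where "e \<in> arcs G" "tail G e = u" "head G e = w"
    using Cons.prems by auto
  ultimately show ?case by (intro exI[of _ "e # P"]) auto
qed

text \<open>The end \<open>v\<close> is split off so that the list between the ends is exactly the
  \<open>inner_verts\<close> that \<open>is_disubdivision\<close> speaks of.\<close>

lemma dominates_walk_imp_path:
  assumes "successively (dominates G) (u # xs @ [v])" "distinct (u # xs @ [v])"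
  obtains P where "apath u P v" "inner_verts P = xs" "awalk_verts u P = u # xs @ [v]"
proof -
  obtain P where P: "set P \<subseteq> arcs G" "cas u P v" "awalk_verts u P = u # xs @ [v]"
    using successively_dominates_imp_arcs[OF assms(1)] by auto
  have "P \<noteq> []" using P(3) by auto
  then have "tail G (hd P) = u" "hd P \<in> arcs G" using P(1,2) by (cases P; auto)+
  then have "u \<in> verts G" using tail_in_verts by blast
  then have "apath u P v" using P assms(2) by (simp add: apath_def awalk_def)
  moreover have "inner_verts P = xs" using inner_verts_conv[of P u] P(3) by simp
  ultimately show thesis using that P(3) by blast
qed

end

text \<open>A subdivided C(2,2) with \<open>p\<close> and \<open>q\<close> as the inner vertices of
  its two paths; each needs a vertex to play the middle vertex of C(2,2), hence the
  nonemptiness.\<close>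

definition theta :: "('a \<Rightarrow> 'a \<Rightarrow> bool) \<Rightarrow> 'a \<Rightarrow> 'a \<Rightarrow> 'a list \<Rightarrow> 'a list \<Rightarrow> bool" where
  "theta E x y p q \<longleftrightarrow> p \<noteq> [] \<and> q \<noteq> [] \<and> distinct (x # y # p @ q) \<and>
     successively E (x # p @ [y]) \<and> successively E (x # q @ [y])"

definition out_nbrs :: "('a \<Rightarrow> 'a \<Rightarrow> bool) \<Rightarrow> 'a set \<Rightarrow> 'a set" where
  "out_nbrs E S = {w. w \<notin> S \<and> (\<exists>u\<in>S. E u w)}"

theorem theorem14:
  fixes D :: "('a, 'b) pre_digraph"
  assumes "oriented_graph D"
    and "verts D \<noteq> {}"
    and "min_out_degree D \<ge> 2"
  shows "contains_disubdivision D (with_proj C22)"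
proof -
  interpret oriented_graph D by (rule assms(1))

  \<comment> \<open>Disjoint paths from one vertex to two others\<close>
  txt \<open>An augmenting argument: \<open>A\<close> and \<open>B\<close> are two disjoint walks from \<open>a\<close> to \<open>v\<close>, continued
    by \<open>T\<close> to \<open>x\<close>. A walk avoiding \<open>v\<close> leaves the two walks for the last time and then hits either
    \<open>d\<close>, giving the fan, or the tail \<open>T\<close>, which becomes shorter.\<close>
  have two_fan_augment: "\<exists>p q. distinct (a # x # d # p @ q) \<and>
        successively E (a # p @ [x]) \<and> successively E (a # q @ [d])"
    if sep: "\<And>v. v \<noteq> a \<Longrightarrow> \<exists>r w. w \<in> {x, d} - {v} \<and> set r \<inter> {v, x, d} = {} \<and>
        successively E (a # r @ [w]) \<and> distinct (a # r @ [w])"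
      and walks: "distinct (a # A @ B @ v # T)" "d \<notin> set (a # A @ B @ v # T)"
      "successively E (a # A @ v # T)" "successively E (a # B @ v # T)" "last (v # T) = x"
    for E :: "'a \<Rightarrow> 'a \<Rightarrow> bool" and a x d A B v T
    using walks
  proof (induction "length T" arbitrary: A B v T rule: less_induct)
    case less
    let ?goal = "\<exists>p q. distinct (a # x # d # p @ q) \<and>
        successively E (a # p @ [x]) \<and> successively E (a # q @ [d])"
    have xT: "x \<in> set (v # T)" using less.prems(5) by (metis last_in_set list.discI)
    obtain r w where rw: "w \<in> {x, d} - {v}" "set r \<inter> {v, x, d} = {}"
      "successively E (a # r @ [w])" "distinct (a # r @ [w])"
      using sep[of v] less.prems(1) by auto
    \<comment> \<open>\<open>c\<close> is the last vertex of the detour that lies on the two walks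
      before \<open>v\<close>; the start \<open>a\<close> is always a candidate.\<close>
    have "\<exists>u\<in>set (a # r @ [w]). u \<in> set (a # A @ B)" by auto
    from split_list_last_prop[OF this] obtain R1 c R2 where R: "a # r @ [w] = R1 @ c # R2"
      "c \<in> set (a # A @ B)" "\<forall>u\<in>set R2. u \<notin> set (a # A @ B)" by blast
    have w_nin: "w \<notin> set (a # A @ B)" using rw(1) xT less.prems(1,2) by auto
    then have R2: "R2 \<noteq> []" using R(1,2) by (metis last_snoc append_Cons)
    then have "w \<in> set R2" using R(1)
      by (metis last_ConsR last_appendR last_in_set last_snoc append_Cons list.discI)
    moreover have "w \<in> insert d (set T)" using rw(1) xT by auto
    \<comment> \<open>After \<open>c\<close>, let \<open>t\<close> be the first vertex that is
      \<open>d\<close> or on \<open>T\<close>. The stretch \<open>M\<close> in between then consists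
      of new vertices.\<close>
    ultimately have "\<exists>u\<in>set R2. u \<in> insert d (set T)" by blast
    from split_list_first_prop[OF this] obtain M t R3 where M: "R2 = M @ t # R3"
      "t \<in> insert d (set T)" "\<forall>u\<in>set M. u \<notin> insert d (set T)" by blast
    have "v \<noteq> a" using less.prems(1) by auto
    then have v_nin: "v \<notin> set (a # r @ [w])" using rw(1,2) by auto
    have walk: "successively E (c # M @ [t])"
      using rw(3) unfolding R(1) M(1) by (auto simp: successively_simps)
    have dist: "distinct (c # M @ [t])" using rw(4) unfolding R(1) M(1) by auto
    have M_nin: "set M \<inter> set (a # A @ B @ v # T) = {}" "d \<notin> set M"
      using R(3) M(1,3) v_nin unfolding R(1) by auto
    \<comment> \<open>\<open>A\<close> and \<open>B\<close> are generalised because they swap roles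
      when \<open>c\<close> lies on \<open>B\<close>.\<close>
    have main: ?goal
      if c: "c \<in> set (a # A)" and prems: "distinct (a # A @ B @ v # T)" "d \<notin> set (a # A @ B @ v # T)"
        "successively E (a # A @ v # T)" "successively E (a # B @ v # T)"
        "set M \<inter> set (a # A @ B @ v # T) = {}" for A B
    proof -
      obtain A1 A2 where A: "a # A = A1 @ c # A2" using c by (meson split_list)
      \<comment> \<open>\<open>A'\<close> follows \<open>A\<close> up to \<open>c\<close> and
        continues along \<open>M\<close>; the rest \<open>A2\<close> is given up.\<close>
      obtain A' where A': "a # A' = A1 @ c # M" using A by (cases A1) auto
      have set_A': "set A' \<subseteq> set A \<union> set M" using A A' by (cases A1) auto
      have "distinct (A1 @ c # A2)" "set M \<inter> set (A1 @ c # A2) = {}"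
        using prems(1,5) unfolding A[symmetric] by auto
      then have dist_A': "distinct (a # A')" unfolding A' using dist by auto
      have "set (a # A') \<inter> set (B @ v # T) = {}" using prems(1,5) set_A' by auto
      moreover have "distinct (B @ v # T)" using prems(1) by simp
      ultimately have dist_all: "distinct ((a # A') @ B @ v # T)"
        using dist_A' by (simp only: distinct_append)
      have d_nin: "d \<notin> set ((a # A') @ B @ v # T)" using prems(2) set_A' M_nin(2) by auto
      have "successively E ((A1 @ c # A2) @ v # T)" using prems(3) unfolding A[symmetric] by simp
      then have "successively E (A1 @ c # M @ [t])" using walk
        by (auto simp: successively_simps)
      then have walk_A': "successively E (a # A' @ [t])" using A' by (metis append.assoc append_Cons)
      show ?goal
      proof (cases "t = d")
        case True
        \<comment> \<open>\<open>x\<close> may be \<open>v\<close> itself, so the end is split off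
          from \<open>v # T\<close> and not from \<open>T\<close>.\<close>
        have "v # T = butlast (v # T) @ [x]" using less.prems(5) by (metis append_butlast_last_id list.discI)
        then obtain U where U: "v # T = U @ [x]" by blast
        have "distinct (a # x # d # (B @ U) @ A')"
          using dist_all d_nin unfolding U by auto
        moreover have "successively E (a # (B @ U) @ [x])" using prems(4) unfolding U by simp
        ultimately show ?thesis using walk_A' True by blast
      next
        case False
        then obtain T1 T2 where T: "T = T1 @ t # T2" using M(2) by (meson insertE split_list)
        have walk_tail: "successively E (t # T2)"
          using prems(3) unfolding T by (simp add: successively_simps split: if_splits)
        \<comment> \<open>The two walks now meet in \<open>t\<close>, one along \<open>A'\<close>,
          the other through \<open>B\<close>, \<open>v\<close> and \<open>T1\<close>; the remaining
          tail \<open>T2\<close> is shorter than \<open>T\<close>.\<close>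
        have w1: "successively E (a # A' @ t # T2)"
          using walk_A' walk_tail by (auto simp: successively_simps)
        have w2: "successively E (a # (B @ v # T1) @ t # T2)"
          using prems(4) unfolding T by simp
        have d1: "distinct (a # A' @ (B @ v # T1) @ t # T2)"
          using dist_all unfolding T by simp
        have d2: "d \<notin> set (a # A' @ (B @ v # T1) @ t # T2)"
          using d_nin unfolding T by simp
        show ?thesis
          by (rule less.hyps[OF _ d1 d2 w1 w2]) (use T less.prems(5) in auto)
      qed
    qed
    show ?goal
    proof (cases "c \<in> set (a # A)")
      case True
      show ?thesis by (rule main[OF True less.prems(1-4) M_nin(1)])
    next
      case False
      then have c: "c \<in> set (a # B)" using R(2) by auto
      have "distinct (a # B @ A @ v # T)" using less.prems(1) by auto
      moreover have "d \<notin> set (a # B @ A @ v # T)" using less.prems(2) by auto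
      moreover have "set M \<inter> set (a # B @ A @ v # T) = {}" using M_nin(1) by auto
      ultimately show ?thesis using main[OF c] less.prems(3,4) by blast
    qed
  qed
  have two_fan: "\<exists>p q. distinct (a # x # d # p @ q) \<and>
        successively E (a # p @ [x]) \<and> successively E (a # q @ [d])"
    if sep: "\<And>v. v \<noteq> a \<Longrightarrow> \<exists>r w. w \<in> {x, d} - {v} \<and> set r \<inter> {v, x, d} = {} \<and>
        successively E (a # r @ [w]) \<and> distinct (a # r @ [w])" and ad: "a \<noteq> d"
    for E :: "'a \<Rightarrow> 'a \<Rightarrow> bool" and a x d
  proof -
    \<comment> \<open>Taking \<open>d\<close> as separator gives a path from \<open>a\<close> to
      \<open>x\<close> avoiding \<open>d\<close>. Its second vertex serves as \<open>v\<close>, with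
      \<open>A\<close> and \<open>B\<close> empty: both walks to \<open>v\<close> are the same
      single arc.\<close>
    obtain r w where rw: "w \<in> {x, d} - {d}" "set r \<inter> {d, x, d} = {}"
        "successively E (a # r @ [w])" "distinct (a # r @ [w])"
      using sep[of d] ad by auto
    obtain v T where vT: "r @ [w] = v # T" by (cases "r @ [w]") auto
    have last: "last (v # T) = x" unfolding vT[symmetric] using rw(1) by auto
    show ?thesis
      by (rule two_fan_augment[of a x d E "[]" "[]" v T, OF sep])
        (use rw ad last in \<open>auto simp flip: vT\<close>)
  qed

  \<comment> \<open>Extremal sets and the two paths\<close>
  have theta_exists: "\<exists>x y p q. theta E x y p q"
    if fin: "finite V" and ne: "V \<noteq> {}"
      and asym: "\<And>u w. E u w \<Longrightarrow> \<not> E w u"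
      and closed: "\<And>u w. u \<in> V \<Longrightarrow> E u w \<Longrightarrow> w \<in> V"
      and deg: "\<And>u v. u \<in> V \<Longrightarrow> \<exists>w. E u w \<and> w \<noteq> v"
    for E :: "'a \<Rightarrow> 'a \<Rightarrow> bool" and V
  proof -
    have reachable_closed: "w \<in> {w. (\<lambda>u w. E u w \<and> w \<in> S)\<^sup>*\<^sup>* a w}"
      if "u \<in> {w. (\<lambda>u w. E u w \<and> w \<in> S)\<^sup>*\<^sup>* a w}" "E u w" "w \<in> S" for S a u w
      using that by (auto intro: rtranclp.rtrancl_into_rtrancl)
    have reachable_subset: "{w. (\<lambda>u w. E u w \<and> w \<in> S)\<^sup>*\<^sup>* a w} \<subseteq> S" if "a \<in> S" for S a
      using that by (auto elim: rtranclp.cases)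
    have irrefl: "\<not> E u u" for u using asym by blast
    obtain W where W: "W \<subseteq> V" "W \<noteq> {} \<and> (\<forall>u\<in>W. \<forall>w. E u w \<longrightarrow> w \<in> W)"
      and W_min: "\<And>U. U \<subseteq> W \<Longrightarrow> U \<noteq> {} \<and> (\<forall>u\<in>U. \<forall>w. E u w \<longrightarrow> w \<in> U) \<Longrightarrow> U = W"
      using minimal_subset[OF fin, of "\<lambda>W. W \<noteq> {} \<and> (\<forall>u\<in>W. \<forall>w. E u w \<longrightarrow> w \<in> W)"] ne closed
      by blast
    have finW: "finite W" using W(1) fin finite_subset by blast
    have "out_nbrs E W = {}" using W(2) by (auto simp: out_nbrs_def)
    then have "W \<noteq> {} \<and> (\<exists>d. out_nbrs E W \<subseteq> {d})" using W by simp
    from minimal_subset[OF finW, where P = "\<lambda>S. S \<noteq> {} \<and> (\<exists>d. out_nbrs E S \<subseteq> {d})", OF this]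
    obtain S where S: "S \<subseteq> W" "S \<noteq> {}" "\<exists>d. out_nbrs E S \<subseteq> {d}"
      and S_min: "\<And>U d. U \<subseteq> S \<Longrightarrow> U \<noteq> {} \<Longrightarrow> out_nbrs E U \<subseteq> {d} \<Longrightarrow> U = S"
      by metis
    \<comment> \<open>If nothing lay outside, \<open>S - {v}\<close> would have at most
      \<open>v\<close> as out-neighbour, and an out-neighbour of \<open>v\<close> keeps it
      nonempty.\<close>
    have "out_nbrs E S \<noteq> {}"
    proof
      assume no: "out_nbrs E S = {}"
      obtain v where v: "v \<in> S" using S(2) by blast
      have "v \<in> V" using v S(1) W(1) by blast
      then obtain w where "E v w" "w \<noteq> v" using deg by blast
      then have "w \<in> S - {v}" using no v by (auto simp: out_nbrs_def)
      moreover have "out_nbrs E (S - {v}) \<subseteq> {v}" using no by (auto simp: out_nbrs_def)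
      ultimately have "S - {v} = S" using S_min[of "S - {v}" v] by blast
      then show False using v by blast
    qed
    then obtain d where d: "out_nbrs E S = {d}" using S(3) by blast
    have dS: "d \<notin> S" and dW: "d \<in> W" using d S(1) W(2) by (auto simp: out_nbrs_def)
    have out: "w \<in> insert d S" if "u \<in> S" "E u w" for u w
      using d that by (auto simp: out_nbrs_def)
    have strong: "(\<lambda>u w. E u w \<and> w \<in> S)\<^sup>*\<^sup>* a b" if "a \<in> S" "b \<in> S" for a b
    proof -
      let ?R = "{w. (\<lambda>u w. E u w \<and> w \<in> S)\<^sup>*\<^sup>* a w}"
      have "?R \<subseteq> S" by (rule reachable_subset[OF that(1)])
      \<comment> \<open>An arc leaving \<open>?R\<close> cannot end in \<open>S\<close>, where its
        head would be reachable, so it ends in \<open>d\<close>.\<close>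
      moreover have "out_nbrs E ?R \<subseteq> {d}"
        using reachable_closed[of _ S a] out calculation unfolding out_nbrs_def by blast
      moreover have "?R \<noteq> {}" by blast
      ultimately have "?R = S" using S_min by blast
      then show ?thesis using that(2) by blast
    qed
    show ?thesis
    proof (rule ccontr)
      assume no_theta: "\<not> ?thesis"
      have to_d: "E a d" if x: "x \<in> S" "E x d" and a: "a \<in> S" "E x a" for x a
      proof (rule ccontr)
        assume nad: "\<not> E a d"
        have "\<exists>r w. w \<in> {x, d} - {v} \<and> set r \<inter> {v, x, d} = {} \<and>
            successively E (a # r @ [w]) \<and> distinct (a # r @ [w])" if v: "v \<noteq> a" for v
        proof -
          let ?S = "S - {v, x}"
          let ?R = "{w. (\<lambda>u w. E u w \<and> w \<in> ?S)\<^sup>*\<^sup>* a w}"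
          have aS: "a \<in> ?S" using a v irrefl by auto
          have R: "?R \<subseteq> ?S" by (rule reachable_subset[OF aS])
          \<comment> \<open>\<open>?R\<close> misses \<open>x\<close>, so it is smaller than
            \<open>S\<close> and has an out-neighbour \<open>w\<close> other than \<open>v\<close>.
            As \<open>w\<close> is outside \<open>?S\<close>, it is \<open>x\<close> or
            \<open>d\<close>.\<close>
          have "\<not> out_nbrs E ?R \<subseteq> {v}"
          proof
            assume "out_nbrs E ?R \<subseteq> {v}"
            moreover have "?R \<noteq> {}" by blast
            ultimately have "?R = S" using S_min[of ?R v] R by blast
            then show False using R x(1) by blast
          qed
          then obtain w u where w: "w \<notin> ?R" "u \<in> ?R" "E u w" "w \<noteq> v"
            unfolding out_nbrs_def by blast
          have "w \<notin> ?S" using reachable_closed[OF w(2,3)] w(1) by blast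
          moreover have "w \<in> insert d S" using out[OF _ w(3)] w(2) R by blast
          ultimately have w': "w \<in> {x, d} - {v}" using w(4) by blast
          obtain r where r: "successively E (a # r)" "last (a # r) = u" "set r \<subseteq> ?S" "distinct (a # r)"
            using rtranclp_into_distinct_walk[of E ?S a u] w(2) by blast
          have "successively E ((a # r) @ [w])"
            using r(1,2) w(3) by (subst successively_append_iff) auto
          moreover have "w \<notin> set (a # r)" using w' r(3) aS dS by auto
          ultimately show ?thesis using w' r(3,4) dS by (intro exI[of _ r] exI[of _ w]) auto
        qed
        moreover have "a \<noteq> d" using a dS by blast
        ultimately obtain p q where pq: "distinct (a # x # d # p @ q)"
          "successively E (a # p @ [x])" "successively E (a # q @ [d])"
          using two_fan[of a x d E] by blast
        have "q \<noteq> []" using pq(3) nad by auto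
        moreover have "successively E ((a # p @ [x]) @ [d])"
          using pq(2) x(2) by (subst successively_append_iff) auto
        ultimately have "theta E a d (p @ [x]) q" using pq by (auto simp: theta_def)
        then show False using no_theta by blast
      qed
      have all_to_d: "E u d" if "u \<in> S" for u
      proof -
        let ?S0 = "{x \<in> S. E x d}"
        \<comment> \<open>By \<open>to_d\<close>, dominating \<open>d\<close> is inherited by
          out-neighbours in \<open>S\<close>.\<close>
        have "out_nbrs E ?S0 \<subseteq> {d}" using to_d out unfolding out_nbrs_def by blast
        moreover have "?S0 \<noteq> {}" using d by (auto simp: out_nbrs_def)
        ultimately have "?S0 = S" using S_min[of ?S0 d] by blast
        then show ?thesis using that by blast
      qed
      have reach: "(\<lambda>u w. E u w \<and> w \<in> W)\<^sup>*\<^sup>* d b" if "b \<in> W" for b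
      proof -
        let ?R = "{w. (\<lambda>u w. E u w \<and> w \<in> W)\<^sup>*\<^sup>* d w}"
        have R: "?R \<subseteq> W" by (rule reachable_subset[OF dW])
        have "w \<in> ?R" if "u \<in> ?R" "E u w" for u w
        proof (rule reachable_closed[OF that])
          have "u \<in> W" using R that(1) by (rule subsetD)
          then show "w \<in> W" using W(2) that(2) by blast
        qed
        then have "?R = W" using W_min[OF R] by blast
        then show ?thesis using that by blast
      qed
      obtain s0 where s0: "s0 \<in> S" using S(2) by blast
      then obtain ys where ys: "successively E (d # ys)" "last (d # ys) = s0" "distinct (d # ys)"
        using rtranclp_into_distinct_walk[OF reach] S(1) by blast
      have "s0 \<in> set ys" using ys(2) s0 dS by (auto split: if_splits)
      then have "\<exists>u\<in>set ys. u \<in> S" using s0 by blast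
      from split_list_first_prop[OF this] obtain zs s ws where split: "ys = zs @ s # ws" "s \<in> S"
        "\<forall>u\<in>set zs. u \<notin> S" by blast
      have ds: "successively E ((d # zs) @ [s])" "distinct ((d # zs) @ [s])"
        using ys(1,3) unfolding split(1) successively_append_iff[of E "(d # zs) @ [s]" ws, simplified]
        by auto
      have "s \<in> V" using split(2) S(1) W(1) by blast
      then obtain x where x: "E s x" "x \<noteq> d" using deg by blast
      have xS: "x \<in> S" using out[OF split(2) x(1)] x(2) by blast
      obtain us where us: "successively E (x # us)" "last (x # us) = s" "set us \<subseteq> S" "distinct (x # us)"
        using rtranclp_into_distinct_walk[OF strong[OF xS split(2)]] by blast
      have "x \<noteq> s" using x(1) irrefl by blast
      then have "us \<noteq> []" using us(2) by auto
      then obtain q where q: "us = q @ [s]" using us(2) by (metis append_butlast_last_id last_ConsR)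
      have "q \<noteq> []" using us(1) x(1) asym unfolding q by auto
      moreover have "successively E (x # (d # zs) @ [s])"
        using ds(1) all_to_d[OF xS] by simp
      \<comment> \<open>\<open>zs\<close> avoids \<open>S\<close> by the choice of \<open>s\<close>,
        while \<open>q\<close> lies inside \<open>S\<close>.\<close>
      moreover have "distinct (x # s # (d # zs) @ q)"
        using ds(2) us(3,4) xS dS split(3) unfolding q by auto
      ultimately have "theta E x s (d # zs) q" using us(1) unfolding theta_def q by simp
      then show False using no_theta by blast
    qed
  qed

  \<comment> \<open>Realising the two paths as a subdivision in \<open>D\<close>\<close>
  have deg: "\<exists>w. u \<rightarrow>\<^bsub>D\<^esub> w \<and> w \<noteq> v" if "u \<in> verts D" for u v
  proof (rule ccontr)
    assume "\<not> ?thesis"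
    then have "head D e = v" if "e \<in> out_arcs D u" for e
      using that in_arcs_imp_in_arcs_ends[of e] by auto
    \<comment> \<open>Two out-arcs of \<open>u\<close> with the common head \<open>v\<close> would
      be parallel.\<close>
    then have "e = f" if "e \<in> out_arcs D u" "f \<in> out_arcs D u" for e f
      using that no_multi_arcs[of e f] by (auto simp: arc_to_ends_def)
    then have "card (out_arcs D u) \<le> 1"
      by (metis card_le_Suc0_iff_eq One_nat_def card.infinite zero_le)
    moreover have "min_out_degree D \<le> out_degree D u"
      using that by (simp add: min_out_degree_def)
    ultimately show False using assms(3) by (simp add: out_degree_def)
  qed
  have "\<exists>x y p q. theta (dominates D) x y p q"
    by (rule theta_exists[OF finite_verts assms(2)]) (use no_digon deg in auto)
  then obtain x y p q where theta: "theta (dominates D) x y p q" by blast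
  \<comment> \<open>The first inner vertices \<open>b\<close> and \<open>c\<close> become the middle
    vertices of C(2,2): the arcs at \<open>x\<close> stay unsubdivided, and \<open>p'\<close> and
    \<open>q'\<close> go on the arcs into \<open>y\<close>.\<close>
  obtain b p' where p: "p = b # p'" using theta by (cases p) (auto simp: theta_def)
  obtain c q' where q: "q = c # q'" using theta by (cases q) (auto simp: theta_def)
  have dist: "distinct (x # y # b # c # p' @ q')"
    and walks: "successively (dominates D) (x # [] @ [b])" "successively (dominates D) (b # p' @ [y])"
      "successively (dominates D) (x # [] @ [c])" "successively (dominates D) (c # q' @ [y])"
    using theta by (auto simp: theta_def p q)
  obtain P1 where P1: "apath x P1 b" "inner_verts P1 = []"
    "awalk_verts x P1 = [x, b]"
    using dominates_walk_imp_path[OF walks(1)] dist by auto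
  obtain P2 where P2: "apath b P2 y" "inner_verts P2 = p'"
    "awalk_verts b P2 = b # p' @ [y]"
    using dominates_walk_imp_path[OF walks(2)] dist by auto
  obtain P3 where P3: "apath x P3 c" "inner_verts P3 = []"
    "awalk_verts x P3 = [x, c]"
    using dominates_walk_imp_path[OF walks(3)] dist by auto
  obtain P4 where P4: "apath c P4 y" "inner_verts P4 = q'"
    "awalk_verts c P4 = c # q' @ [y]"
    using dominates_walk_imp_path[OF walks(4)] dist by auto
  \<comment> \<open>Only the four paths are kept, as a subdivision may contain nothing else.\<close>
  define H where "H = \<lparr>verts = {x, y, b, c} \<union> set p' \<union> set q',
    arcs = set P1 \<union> set P2 \<union> set P3 \<union> set P4, tail = tail D, head = head D\<rparr>"
  have H [simp]: "verts H = {x, y, b, c} \<union> set p' \<union> set q'"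
    "arcs H = set P1 \<union> set P2 \<union> set P3 \<union> set P4" "tail H = tail D" "head H = head D"
    by (simp_all add: H_def)
  have sets: "set (awalk_verts x P1) = {x, b}" "set (awalk_verts b P2) = {b, y} \<union> set p'"
    "set (awalk_verts x P3) = {x, c}" "set (awalk_verts c P4) = {c, y} \<union> set q'"
    using P1(3) P2(3) P3(3) P4(3) by auto
  have in_G: "set (awalk_verts u P) \<subseteq> verts D" "set P \<subseteq> arcs D" if "apath u P v" for u P v
    using that unfolding apath_def by (auto elim!: awalkE)
  have sub: "verts H \<subseteq> verts D" "arcs H \<subseteq> arcs D"
    using in_G[OF P1(1)] in_G[OF P2(1)] in_G[OF P3(1)] in_G[OF P4(1)] sets by auto
  have ends: "tail D e \<in> verts H \<and> head D e \<in> verts H" if e: "e \<in> arcs H" for e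
  proof -
    have on_path: "tail D e \<in> verts H \<and> head D e \<in> verts H"
      if "e \<in> set P" "apath u P v" "set (awalk_verts u P) \<subseteq> verts H" for u P v
      using that set_awalk_verts[of u P v] unfolding apath_def by (auto simp del: H)
    consider "e \<in> set P1" | "e \<in> set P2" | "e \<in> set P3" | "e \<in> set P4"
      using e by auto
    then show ?thesis
    proof cases
      case 1
      show ?thesis by (rule on_path[OF 1 P1(1)]) (simp add: sets)
    next
      case 2
      show ?thesis by (rule on_path[OF 2 P2(1)]) (auto simp: sets)
    next
      case 3
      show ?thesis by (rule on_path[OF 3 P3(1)]) (simp add: sets)
    next
      case 4
      show ?thesis by (rule on_path[OF 4 P4(1)]) (auto simp: sets)
    qed
  qed
  have digraph_H: "digraph H"
  proof
    show "tail H e \<in> verts H" "head H e \<in> verts H" if "e \<in> arcs H" for e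
      using ends[OF that] by simp_all
    show "finite (verts H)" "finite (arcs H)" by simp_all
    show "tail H e \<noteq> head H e" if "e \<in> arcs H" for e
      using no_loops that sub(2) by auto
    show "e = f" if "e \<in> arcs H" "f \<in> arcs H" "arc_to_ends H e = arc_to_ends H f" for e f
      using no_multi_arcs[of e f] that sub(2) by (auto simp: arc_to_ends_def)
  qed
  then have wf_H: "wf_digraph H"
    by (simp add: digraph_def fin_digraph_def)
  have subH: "subgraph H D" using sub wf_digraph wf_H
    by (simp add: subgraph_def compatible_def)
  have compat: "compatible H D" by (simp add: compatible_def)
  have inner_H: "pre_digraph.inner_verts H = inner_verts"
    by (simp add: fun_eq_iff pre_digraph.inner_verts_def)
  \<comment> \<open>\<open>H\<close> keeps the tails and heads of \<open>D\<close>, so a path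
    carries over once its arcs and its start lie in \<open>H\<close>.\<close>
  have path_H: "pre_digraph.apath H u P v" if "apath u P v" "set P \<subseteq> arcs H" "u \<in> verts H" for u P v
    using that compatible_cas[OF compat] compatible_awalk_verts[OF compat]
    by (simp add: pre_digraph.apath_def pre_digraph.awalk_def)
  have paths_H: "pre_digraph.apath H x P1 b" "pre_digraph.apath H b P2 y"
    "pre_digraph.apath H x P3 c" "pre_digraph.apath H c P4 y"
    using path_H[OF P1(1)] path_H[OF P2(1)] path_H[OF P3(1)] path_H[OF P4(1)] by auto
  \<comment> \<open>The final \<open>else\<close> branches serve the vertex 3 and the arc
    \<open>(2, 3)\<close>.\<close>
  define \<phi> where "\<phi> = (\<lambda>n::nat. if n = 0 then x else if n = 1 then b else if n = 2 then c else y)"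
  define Q where "Q = (\<lambda>a::nat \<times> nat. if a = (0, 1) then P1 else if a = (1, 3) then P2
    else if a = (0, 2) then P3 else P4)"
  have [simp]: "\<phi> 0 = x" "\<phi> 1 = b" "\<phi> (Suc 0) = b" "\<phi> 2 = c" "\<phi> 3 = y"
    by (simp_all add: \<phi>_def)
  have [simp]: "Q (0, 1) = P1" "Q (0, Suc 0) = P1" "Q (1, 3) = P2" "Q (Suc 0, 3) = P2"
    "Q (0, 2) = P3" "Q (2, 3) = P4"
    by (simp_all add: Q_def)
  have C22 [simp]: "pverts C22 = {0, 1, 2, 3}" "parcs C22 = {(0, 1), (1, 3), (0, 2), (2, 3)}"
    by (simp_all add: C22_def)
  have "is_disubdivision (with_proj C22) H"
    unfolding is_disubdivision_def
  proof (intro conjI exI[of _ \<phi>] exI[of _ Q])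
    show "digraph (with_proj C22)" by (rule digraph_C22)
    show "digraph H" by (rule digraph_H)
    show "inj_on \<phi> (verts (with_proj C22))" using dist by auto
  qed (use dist P1(2) P2(2) P3(2) P4(2) paths_H in \<open>auto simp: inner_H\<close>)
  then show ?thesis using subH by (auto simp: contains_disubdivision_def)
qed

end
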